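(* Let $\alpha$ be a badly approximable irrational. There is a constant $C=C(\alpha)>0$ depending only on $\alpha$ such that for every integer $M\ge 1$ and every real $t>0$, \[ \left| \frac{1}{M}\left|\left\{1\le N\le M : N^{1/2}e^{-t\sqrt{\log 2N}}\le P_N(\alpha)\le N^{1/2}e^{t\sqrt{\log 2N}}\right\}\right| - 1\right| \le C t^{-2}. \] In particular, for any sequence of reals $t_N\to\infty$ the set \[ \left\{N\in\mathbb{N} : N^{1/2}e^{-t_N\sqrt{\log N}}\le P_N(\alpha)\le N^{1/2}e^{t_N\sqrt{\log N}}\right\} \] has asymptotic density $1$.
   Context: The Sudler product is $P_N(\alpha)=\prod_{n=1}^N |2\sin(\pi n\alpha)|$. $\|\cdot\|$ denotes the distance from the nearest integer. An irrational $\alpha$ is badly approximable if $\inf_{q\ge 1} q\|q\alpha\|>0$, where $q$ ranges over positive integers. In the first displayed formula $N$ ranges over integers and $|\{\dots\}|$ is cardinality. *)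

theory Defs
  imports "HOL-Analysis.Analysis"
begin

definition dist_nearest_int :: "real \<Rightarrow> real" where
  "dist_nearest_int x = \<bar>x - of_int (round x)\<bar>"

(* The set of values is bounded below by 0, so the conditionally complete INF on the
   reals is the genuine infimum here. *)
definition badly_approximable :: "real \<Rightarrow> bool" where
  "badly_approximable \<alpha> \<longleftrightarrow>
     \<alpha> \<notin> \<rat> \<and> (INF q\<in>{1::nat..}. real q * dist_nearest_int (real q * \<alpha>)) > 0"

definition sudler :: "nat \<Rightarrow> real \<Rightarrow> real" where
  "sudler N \<alpha> = (\<Prod>n=1..N. \<bar>2 * sin (pi * real n * \<alpha>)\<bar>)"

definition has_asymptotic_density :: "nat set \<Rightarrow> real \<Rightarrow> bool" where
  "has_asymptotic_density A d \<longleftrightarrow>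
     (\<lambda>M. real (card (A \<inter> {1..M})) / real M) \<longlonglongrightarrow> d"

end

theory Submission
  imports Defs
begin

text \<open>
  Write \<open>f x = ln \<bar>2 sin (\<pi> x)\<bar>\<close>, so that \<open>ln (sudler N \<alpha>)\<close> is the sum of \<open>f (n \<alpha>)\<close> over
  \<open>1 \<le> n \<le> N\<close>. The Fourier series of \<open>f\<close> is \<open>- \<Sum>\<^sub>m cos (2 \<pi> m x) / m\<close>, and formally, summing the cosines
  over \<open>n\<close>,
  \<open>ln (sudler N \<alpha>) = \<Sum>\<^sub>m 1 / (2 m) - \<Sum>\<^sub>m sin ((2 N + 1) \<pi> m \<alpha>) / (2 m sin (\<pi> m \<alpha>))\<close>.
  Cut off at \<open>m \<approx> N\<close>, the first sum is \<open>ln N / 2\<close>, the typical value. In the second sum, averaging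
  over \<open>N\<close> makes different frequencies nearly orthogonal, so its mean square should be of order
  \<open>\<Sum>\<^sub>m 1 / (m sin (\<pi> m \<alpha>))\<^sup>2\<close>, which for badly approximable \<open>\<alpha>\<close> grows only logarithmically.
  So the second moment of \<open>ln (sudler N \<alpha>) - ln N / 2\<close> is \<open>O(log N)\<close>, and Chebyshev's inequality
  gives the theorem.

  To make this rigorous for \<open>N \<le> M\<close>, the function \<open>f\<close> is replaced by its Poisson integral with
  radius \<open>r = M / (M + 1)\<close>, which multiplies the \<open>m\<close>-th Fourier coefficient by \<open>r\<^sup>m\<close> and hence acts as a
  cutoff at \<open>m \<approx> M\<close>. By \<open>abs_ln_sin_minus_ln_poisson_le\<close> the error at \<open>x\<close> is
  \<open>O(1 / M + 1 / (M sin (\<pi> x))\<^sup>2)\<close>, and \<open>sum_inverse_sin_squared_le\<close> shows that over all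
  \<open>n \<le> M\<close> these errors add up to \<open>O(1)\<close>. The result is the decomposition
  \<open>ln_sudler_decomposition\<close>.

  The orthogonality is the large sieve inequality \<open>sum_norm_exp_poly_le\<close>, which uses the squared
  Dirichlet kernel. The only arithmetic input is that the points \<open>n \<alpha>\<close> with \<open>n\<close> in an interval
  of length \<open>X\<close> are \<open>c / X\<close>-separated modulo 1. It enters through \<open>sum_le_of_separated_mod_1\<close> and
  yields both the bound for the kernels (\<open>weighted_sum_exp_sum_le\<close>) and that for the coefficients
  (\<open>weighted_sum_inverse_sin_squared_le\<close>); together they bound the second moment in
  \<open>osc_partial_second_moment\<close>.
\<close>

section \<open>Distance to the nearest integer\<close>

lemma dist_nearest_int_le: "dist_nearest_int x \<le> \<bar>x - of_int k\<bar>"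
  unfolding dist_nearest_int_def by (rule round_diff_minimal)

lemma dist_nearest_int_nonneg: "0 \<le> dist_nearest_int x"
  by (simp add: dist_nearest_int_def)

lemma dist_nearest_int_minus: "dist_nearest_int (- x) = dist_nearest_int x"
proof -
  have le: "dist_nearest_int (- y) \<le> dist_nearest_int y" for y
    using dist_nearest_int_le[of "- y" "- round y"] by (simp add: dist_nearest_int_def)
  from le[of x] le[of "- x"] show ?thesis by simp
qed

lemma jordan_sin_lower:
  fixes y :: real
  assumes "0 \<le> y" "y \<le> 1 / 2"
  shows "2 * y \<le> sin (pi * y)"
proof -
  have "convex_on {0..pi/2} (\<lambda>z. - sin z)"
  proof (rule f''_ge0_imp_convex[where f' = "\<lambda>z. - cos z" and f'' = sin])
    show "((\<lambda>z. - sin z) has_real_derivative - cos z) (at z)" for z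
      by (auto intro!: derivative_eq_intros)
    show "((\<lambda>z. - cos z) has_real_derivative sin z) (at z)" for z
      by (auto intro!: derivative_eq_intros)
    show "0 \<le> sin z" if "z \<in> {0..pi/2}" for z
      using that by (intro sin_ge_zero) auto
  qed simp
  from convex_onD[OF this, of "2 * y" 0 "pi / 2"] assms show ?thesis
    by (simp add: field_simps)
qed

lemma abs_sin_pi_ge_dist: "2 * dist_nearest_int x \<le> \<bar>sin (pi * x)\<bar>"
proof -
  define y where "y = x - of_int (round x)"
  have y: "\<bar>y\<bar> \<le> 1 / 2"
    using of_int_round_abs_le[of x] by (simp add: y_def abs_minus_commute)
  have "pi * x = pi * y + pi * of_int (round x)"
    by (simp add: y_def algebra_simps)
  then have "\<bar>sin (pi * x)\<bar> = \<bar>sin (pi * y)\<bar>"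
    by (simp add: sin_add abs_mult cos_npi_int)
  also have "\<dots> = \<bar>sin (pi * \<bar>y\<bar>)\<bar>"
    by (simp add: abs_if)
  also have "\<dots> \<ge> 2 * \<bar>y\<bar>"
    using jordan_sin_lower[of "\<bar>y\<bar>"] y by linarith
  finally show ?thesis by (simp add: y_def dist_nearest_int_def)
qed

section \<open>Sums over separated points and summation by parts\<close>

lemma square_add_le: "(x + y)\<^sup>2 \<le> 2 * x\<^sup>2 + 2 * (y::real)\<^sup>2"
  using zero_le_power2[of "x - y"] by (simp add: power2_eq_square algebra_simps)

lemma sum_inverse_squares_le: "(\<Sum>k=1..n. 1 / (real k)\<^sup>2) \<le> 2"
proof -
  have "(\<Sum>k=1..n. 1 / (real k)\<^sup>2) \<le> 2 - 1 / real n"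
  proof (induction n)
    case (Suc n)
    show ?case
    proof (cases "n = 0")
      case False
      then have "1 / (real (Suc n))\<^sup>2 \<le> 1 / real n - 1 / real (Suc n)"
      proof -
        have "1 / (real (Suc n))\<^sup>2 \<le> 1 / (real n * real (Suc n))"
          using False unfolding power2_eq_square by (intro frac_le mult_right_mono) auto
        also have "\<dots> = 1 / real n - 1 / real (Suc n)"
          using False by (simp add: field_simps)
        finally show ?thesis .
      qed
      with Suc show ?thesis by simp
    qed simp
  qed simp
  then show ?thesis by (smt (verit) divide_nonneg_nonneg of_nat_0_le_iff)
qed

text \<open>
  At most two of the \<open>\<delta>\<close>-separated points, one on either side of the nearest integer, have a
  distance from it in \<open>[k\<delta>, (k + 1)\<delta>)\<close>. The points with \<open>k = 0\<close>
  contribute at most \<open>2 A\<close>, the others at most \<open>2 \<Sum>\<^sub>k B / (k\<delta>)\<^sup>2 \<le> 4 B / \<delta>\<^sup>2\<close>. Having both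
  bounds at once is what makes the estimate usable for Dirichlet kernels, which are large but bounded
  near the integers.
\<close>

lemma sum_le_of_separated_mod_1:
  fixes x :: "'i \<Rightarrow> real" and F :: "'i \<Rightarrow> real"
  assumes fin: "finite I" and \<delta>: "\<delta> > 0" and A: "A \<ge> 0" and B: "B \<ge> 0"
    and sep: "\<And>i j. i \<in> I \<Longrightarrow> j \<in> I \<Longrightarrow> i \<noteq> j \<Longrightarrow> \<delta> \<le> dist_nearest_int (x i - x j)"
    and FA: "\<And>i. i \<in> I \<Longrightarrow> F i \<le> A"
    and FB: "\<And>i. i \<in> I \<Longrightarrow> dist_nearest_int (x i) > 0 \<Longrightarrow> F i \<le> B / (dist_nearest_int (x i))\<^sup>2"
  shows "sum F I \<le> 2 * A + 4 * B / \<delta>\<^sup>2"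
proof -
  define y where "y i = x i - of_int (round (x i))" for i
  define k where "k i = nat \<lfloor>\<bar>y i\<bar> / \<delta>\<rfloor>" for i
  define G where "G n = (if n = 0 then A else B / \<delta>\<^sup>2 * (1 / (real n)\<^sup>2))" for n :: nat
  have dist_y: "dist_nearest_int (x i) = \<bar>y i\<bar>" for i
    by (simp add: y_def dist_nearest_int_def)
  have k_le: "real (k i) * \<delta> \<le> \<bar>y i\<bar>" and k_gt: "\<bar>y i\<bar> < (real (k i) + 1) * \<delta>" for i
  proof -
    have "real (k i) = of_int \<lfloor>\<bar>y i\<bar> / \<delta>\<rfloor>" using \<delta> by (simp add: k_def)
    then have "real (k i) \<le> \<bar>y i\<bar> / \<delta>" "\<bar>y i\<bar> / \<delta> < real (k i) + 1" by linarith+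
    then show "real (k i) * \<delta> \<le> \<bar>y i\<bar>" "\<bar>y i\<bar> < (real (k i) + 1) * \<delta>"
      using \<delta> by (simp_all add: field_simps)
  qed
  have F_G: "F i \<le> G (k i)" if "i \<in> I" for i
  proof (cases "k i = 0")
    case True
    then show ?thesis using FA[OF that] by (simp add: G_def)
  next
    case False
    then have pos: "0 < real (k i) * \<delta>" using \<delta> by simp
    then have "F i \<le> B / \<bar>y i\<bar>\<^sup>2"
      using FB[OF that] k_le[of i] by (simp add: dist_y)
    also have "\<dots> \<le> B / (real (k i) * \<delta>)\<^sup>2"
      using k_le[of i] less_le_trans[OF pos k_le[of i]] B False \<delta>
      by (intro divide_left_mono power_mono mult_pos_pos zero_less_power) auto
    finally show ?thesis using False by (simp add: G_def power_mult_distrib mult.commute)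
  qed
  have G0: "G n \<ge> 0" for n using A B by (simp add: G_def)
  \<comment> \<open>On a set of points lying on one side of the integers, the cell number is injective.\<close>
  have half: "sum F J \<le> A + 2 * B / \<delta>\<^sup>2"
    if J: "J \<subseteq> I" and sgn: "\<And>i j. i \<in> J \<Longrightarrow> j \<in> J \<Longrightarrow> \<bar>y i - y j\<bar> = \<bar>\<bar>y i\<bar> - \<bar>y j\<bar>\<bar>" for J
  proof -
    have finJ: "finite J" using J fin finite_subset by blast
    have inj: "inj_on k J"
    proof (rule inj_onI, rule ccontr)
      fix i j assume ij: "i \<in> J" "j \<in> J" "k i = k j" "i \<noteq> j"
      have "\<delta> \<le> dist_nearest_int (x i - x j)" using sep ij J by blast
      also have "\<dots> \<le> \<bar>x i - x j - of_int (round (x i) - round (x j))\<bar>"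
        by (rule dist_nearest_int_le)
      also have "\<dots> = \<bar>\<bar>y i\<bar> - \<bar>y j\<bar>\<bar>"
        using sgn[OF ij(1,2)] by (simp add: y_def algebra_simps)
      also have "\<dots> < \<delta>"
        using k_le[of i] k_gt[of i] k_le[of j] k_gt[of j] ij(3) by (simp add: algebra_simps abs_less_iff)
      finally show False by simp
    qed
    obtain n where n: "k ` J \<subseteq> {0..n}"
      using finJ finite_nat_iff_bounded_le[of "k ` J"] by (auto simp: atMost_atLeast0)
    have "sum F J \<le> (\<Sum>i\<in>J. G (k i))"
      using F_G J by (intro sum_mono) auto
    also have "\<dots> = sum G (k ` J)"
      using inj by (simp add: sum.reindex)
    also have "\<dots> \<le> sum G {0..n}"
      using n G0 by (intro sum_mono2) auto
    also have "\<dots> = A + B / \<delta>\<^sup>2 * (\<Sum>m=1..n. 1 / (real m)\<^sup>2)"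
      by (simp add: sum.atLeast_Suc_atMost[of 0 n] sum_distrib_left G_def)
    also have "\<dots> \<le> A + B / \<delta>\<^sup>2 * 2"
      using B by (intro add_left_mono mult_left_mono sum_inverse_squares_le) auto
    finally show ?thesis by (simp add: mult.commute)
  qed
  have "sum F I = sum F {i \<in> I. y i \<ge> 0} + sum F {i \<in> I. \<not> y i \<ge> 0}"
    using fin by (simp add: sum.inter_filter flip: sum.distrib) (intro sum.cong, auto)
  also have "\<dots> \<le> (A + 2 * B / \<delta>\<^sup>2) + (A + 2 * B / \<delta>\<^sup>2)"
    by (intro add_mono half) auto
  finally show ?thesis by simp
qed

text \<open>
  Against a decreasing weight, only a bound for the partial sums matters: replacing the partial sums
  of \<open>a\<close> by an upper bound \<open>U\<close> amounts to replacing \<open>a\<close> by the increments of \<open>U\<close>. The two later uses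
  have \<open>U\<close> quadratic and \<open>U\<close> affine; in the second one \<open>U 0\<close> is nonzero.
\<close>

lemma sum_by_parts_le:
  fixes a g U :: "nat \<Rightarrow> real"
  assumes U: "\<And>n. (\<Sum>k=1..n. a k) \<le> U n" 
    and g: "\<And>k. k \<ge> 1 \<Longrightarrow> g (Suc k) \<le> g k" "\<And>k. k \<ge> 1 \<Longrightarrow> 0 \<le> g k"
  shows "(\<Sum>k=1..n. a k * g k) \<le> U 0 * g 1 + (\<Sum>k=1..n. (U k - U (k - 1)) * g k)"
proof -
  \<comment> \<open>Abel summation, applied both to \<open>a\<close> and to the increments of \<open>U\<close>.\<close>
  have *: "(\<Sum>k=1..n. b k * g k) = (\<Sum>k=1..n. sum b {1..k} * (g k - g (Suc k))) + sum b {1..n} * g (Suc n)"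
    for b n by (induction n) (simp_all add: algebra_simps)
  define V where "V k = U k - U (k - 1)" for k
  have V: "sum V {1..k} = U k - U 0" for k
    by (induction k) (simp_all add: V_def)
  have "(\<Sum>k=1..n. a k * g k) \<le> (\<Sum>k=1..n. U k * (g k - g (Suc k))) + U n * g (Suc n)"
    unfolding * using g by (intro add_mono sum_mono mult_right_mono U) auto
  also have "\<dots> = U 0 * g 1 + (\<Sum>k=1..n. V k * g k)"
    unfolding * V by (induction n) (simp_all add: algebra_simps)
  finally show ?thesis by (simp add: V_def)
qed

lemma sum_le_by_blocks:
  fixes f :: "nat \<Rightarrow> real"
  assumes M: "M \<ge> 1" and f: "\<And>k. 0 \<le> f k" and block: "\<And>a. (\<Sum>k=a+1..a+M. f k) \<le> B"
  shows "(\<Sum>k=1..X. f k) \<le> B * (real X / real M + 1)"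
proof -
  have "(\<Sum>k=1..M*j. f k) \<le> B * real j" for j
  proof (induction j)
    case (Suc j)
    have "(\<Sum>k=1..M*Suc j. f k) = (\<Sum>k=1..M*j. f k) + (\<Sum>k=M*j+1..M*j+M. f k)"
      using sum.ub_add_nat[of 1 "M*j" f M] by (simp add: add.commute)
    with Suc block[of "M*j"] show ?case by (simp add: algebra_simps)
  qed simp
  moreover have "(\<Sum>k=1..X. f k) \<le> (\<Sum>k=1..M*(X div M + 1). f k)"
  proof (intro sum_mono2)
    have "X \<le> M * (X div M + 1)"
      using M dividend_less_times_div[of M X] by simp
    then show "{1..X} \<subseteq> {1..M*(X div M + 1)}" by auto
  qed (use f in auto)
  ultimately have "(\<Sum>k=1..X. f k) \<le> B * real (X div M + 1)"
    by (metis order.trans)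
  also have "\<dots> \<le> B * (real X / real M + 1)"
  proof (intro mult_left_mono)
    show "0 \<le> B" using order.trans[OF _ block[of 0]] f by (simp add: sum_nonneg)
    show "real (X div M + 1) \<le> real X / real M + 1"
      using of_nat_mono[OF div_times_less_eq_dividend[of X M], where 'a = real] M
      by (simp add: field_simps)
  qed
  finally show ?thesis .
qed

section \<open>The logarithm of the sine and its Poisson smoothing\<close>

text \<open>
  The real part of the power series of \<open>ln (1 - z)\<close> at \<open>z = r cis (2 \<pi> x)\<close>. As \<open>r\<close> tends to 1, the right
  hand side tends to \<open>- ln \<bar>2 sin (\<pi> x)\<bar>\<close>, whose Fourier series converges only conditionally; at
  \<open>x = 0\<close> it is \<open>- ln (1 - r)\<close>.
\<close>

lemma log_poisson_kernel_sums:
  fixes r x :: real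
  assumes r: "0 \<le> r" "r < 1"
  shows "(\<lambda>m. r ^ m * cos (2 * pi * real m * x) / real m) sums
           (- ln ((1 - r)\<^sup>2 + 4 * r * (sin (pi * x))\<^sup>2) / 2)"
proof -
  define z where "z = - of_real r * cis (2 * pi * x)"
  have nz: "cmod z < 1" using r by (simp add: z_def norm_mult)
  then have "1 + z \<noteq> 0"
    by (metis add_eq_0_iff less_irrefl norm_minus_cancel norm_one)
  have "(\<lambda>n. Re (- ((- z) ^ n) / of_nat n)) sums Re (ln (1 + z))"
    by (rule sums_Re[OF Ln_series'[OF nz]])
  moreover have "Re (- ((- z) ^ n) / of_nat n) = - (r ^ n * cos (2 * pi * real n * x) / real n)" for n
    by (simp add: z_def power_mult_distrib Complex.DeMoivre Re_divide_of_nat mult_ac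
             flip: of_real_power)
  moreover have "Re (ln (1 + z)) = ln ((1 - r)\<^sup>2 + 4 * r * (sin (pi * x))\<^sup>2) / 2"
  proof -
    have "(cmod (1 + z))\<^sup>2 = (1 - r * cos (2 * pi * x))\<^sup>2 + (r * sin (2 * pi * x))\<^sup>2"
      by (simp add: cmod_power2 z_def)
    also have "\<dots> = 1 - 2 * r * cos (2 * pi * x) + r\<^sup>2 * ((sin (2 * pi * x))\<^sup>2 + (cos (2 * pi * x))\<^sup>2)"
      by algebra
    also have "\<dots> = (1 - r)\<^sup>2 + 4 * r * (sin (pi * x))\<^sup>2"
    proof -
      have "cos (2 * pi * x) = 1 - 2 * (sin (pi * x))\<^sup>2"
        using cos_double_sin[of "pi * x"] by (simp add: mult.assoc)
      then show ?thesis unfolding sin_cos_squared_add by algebra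
    qed
    finally have eq: "(cmod (1 + z))\<^sup>2 = (1 - r)\<^sup>2 + 4 * r * (sin (pi * x))\<^sup>2" .
    have "Re (ln (1 + z)) = ln (cmod (1 + z))"
      using \<open>1 + z \<noteq> 0\<close> by simp
    also have "\<dots> = ln ((cmod (1 + z))\<^sup>2) / 2"
      using \<open>1 + z \<noteq> 0\<close> by (simp add: ln_realpow)
    finally show ?thesis by (simp only: eq)
  qed
  ultimately have "(\<lambda>n. - (r ^ n * cos (2 * pi * real n * x) / real n)) sums
      (ln ((1 - r)\<^sup>2 + 4 * r * (sin (pi * x))\<^sup>2) / 2)"
    by (simp only:)
  from sums_minus[OF this] show ?thesis by simp
qed

lemma sum_cos_dirichlet:
  fixes \<theta> :: real
  assumes "sin \<theta> \<noteq> 0"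
  shows "(\<Sum>n=1..N. cos (2 * real n * \<theta>)) = (sin ((2 * real N + 1) * \<theta>) / sin \<theta> - 1) / 2"
proof (induction N)
  case (Suc N)
  have "sin ((2 * real (Suc N) + 1) * \<theta>) - sin ((2 * real N + 1) * \<theta>)
      = 2 * sin \<theta> * cos (2 * real (Suc N) * \<theta>)"
  proof -
    have "((2 * real (Suc N) + 1) * \<theta> - (2 * real N + 1) * \<theta>) / 2 = \<theta>"
      "((2 * real (Suc N) + 1) * \<theta> + (2 * real N + 1) * \<theta>) / 2 = 2 * real (Suc N) * \<theta>"
      by (simp_all add: algebra_simps add_divide_distrib diff_divide_distrib)
    then show ?thesis by (simp only: sin_diff_sin)
  qed
  then have "sin ((2 * real (Suc N) + 1) * \<theta>) / sin \<theta>
      = sin ((2 * real N + 1) * \<theta>) / sin \<theta> + 2 * cos (2 * real (Suc N) * \<theta>)"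
    using assms by (simp add: field_simps)
  with Suc show ?case by simp
qed (use assms in simp)

text \<open>
  With \<open>S = sin\<^sup>2 (\<pi> x)\<close>, the two logarithms differ by half of \<open>ln Q\<close> for
  \<open>Q = r + (1 - r)\<^sup>2 / (4 S)\<close>. The point of the Poisson smoothing is that this error decays
  quadratically in the distance of \<open>x\<close> from the integers: such errors can be summed over multiples
  of a badly approximable number without losing a logarithm.
\<close>

lemma abs_ln_sin_minus_ln_poisson_le:
  fixes r x :: real
  assumes r: "0 < r" "r < 1" and x: "sin (pi * x) \<noteq> 0"
  shows "\<bar>ln \<bar>2 * sin (pi * x)\<bar> - ln ((1 - r)\<^sup>2 + 4 * r * (sin (pi * x))\<^sup>2) / 2\<bar>
         \<le> (1 / r - 1) / 2 + (1 - r)\<^sup>2 / 8 * (1 / (sin (pi * x))\<^sup>2)"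
proof -
  define S where "S = (sin (pi * x))\<^sup>2"
  have S: "S > 0" using x by (simp add: S_def)
  define Q where "Q = r + (1 - r)\<^sup>2 / (4 * S)"
  have Q: "Q \<ge> r" using S by (simp add: Q_def)
  have "ln ((1 - r)\<^sup>2 + 4 * r * S) = ln (4 * S * Q)"
    using S by (simp add: Q_def distrib_left mult_ac add_ac)
  also have "\<dots> = ln (4 * S) + ln Q"
    using S Q r by (subst ln_mult) auto
  also have "ln (4 * S) = 2 * ln \<bar>2 * sin (pi * x)\<bar>"
  proof -
    have "4 * S = \<bar>2 * sin (pi * x)\<bar> ^ 2" by (simp add: S_def)
    then show ?thesis using x by (simp only: ln_realpow)
  qed
  finally have eq: "ln \<bar>2 * sin (pi * x)\<bar> - ln ((1 - r)\<^sup>2 + 4 * r * S) / 2 = - ln Q / 2"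
    by linarith
  have upper: "ln Q \<le> Q - 1" using Q r by (intro ln_le_minus_one) auto
  define u where "u = 1 / r"
  have u: "1 \<le> u" using r by (simp add: u_def)
  have lower: "- ln Q \<le> u - 1"
  proof -
    have "ln r \<le> ln Q" using Q r by simp
    moreover have "ln (1 / r) \<le> 1 / r - 1" using r by (intro ln_le_minus_one) auto
    ultimately show ?thesis using r by (simp add: u_def ln_div)
  qed
  have "\<bar>ln \<bar>2 * sin (pi * x)\<bar> - ln ((1 - r)\<^sup>2 + 4 * r * S) / 2\<bar> \<le> (u - 1) / 2 + (Q - r) / 2"
    unfolding eq using upper lower u Q r by (intro abs_leI) (simp_all add: field_simps)
  also have "(Q - r) / 2 = (1 - r)\<^sup>2 / 8 * (1 / S)"
    by (simp add: Q_def)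
  finally show ?thesis by (simp only: S_def u_def)
qed

section \<open>A mean value estimate for exponential polynomials\<close>

definition exp_sum :: "nat \<Rightarrow> real \<Rightarrow> complex" where
  "exp_sum H x = (\<Sum>h<H. cis (2 * pi * x * real h))"

lemma norm_exp_sum_le_length: "cmod (exp_sum H x) \<le> real H"
  unfolding exp_sum_def by (rule order.trans[OF norm_sum]) simp

lemma norm_exp_sum_minus: "cmod (exp_sum H (- x)) = cmod (exp_sum H x)"
proof -
  have "exp_sum H (- x) = cnj (exp_sum H x)"
    by (simp add: exp_sum_def cis_cnj)
  then show ?thesis by simp
qed

lemma norm_exp_sum_le_dist:
  assumes "dist_nearest_int x > 0"
  shows "cmod (exp_sum H x) \<le> 1 / (2 * dist_nearest_int x)"
proof -
  have sin: "2 * dist_nearest_int x \<le> \<bar>sin (pi * x)\<bar>" by (rule abs_sin_pi_ge_dist)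
  have "exp_sum H x * (cis (2 * pi * x) - 1) = cis (2 * pi * x * real H) - 1"
    unfolding exp_sum_def
    by (induction H) (simp_all add: algebra_simps flip: cis_mult)
  then have "cmod (exp_sum H x) * cmod (cis (2 * pi * x) - 1) = cmod (cis (2 * pi * x * real H) - 1)"
    by (simp flip: norm_mult)
  also have "\<dots> \<le> 2"
    by (rule order.trans[OF norm_triangle_ineq4]) simp
  also have "cmod (cis (2 * pi * x) - 1) = 2 * \<bar>sin (pi * x)\<bar>"
  proof -
    have "cis (2 * pi * x) - 1 = 2 * \<i> * of_real (sin (pi * x)) * cis (pi * x)"
      using cos_double_sin[of "pi * x"] sin_double[of "pi * x"]
      by (auto simp: complex_eq_iff power2_eq_square mult_ac)
    then show ?thesis by (simp add: norm_mult)
  qed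
  finally have "cmod (exp_sum H x) * \<bar>sin (pi * x)\<bar> \<le> 1" by simp
  moreover have "cmod (exp_sum H x) * (2 * dist_nearest_int x) \<le> cmod (exp_sum H x) * \<bar>sin (pi * x)\<bar>"
    using sin by (intro mult_left_mono) auto
  ultimately show ?thesis using assms by (simp add: field_simps)
qed

text \<open>
  A large sieve inequality. Each \<open>N\<close> with \<open>1 \<le> N \<le> M\<close> is a difference \<open>h - h'\<close> with \<open>h, h' < 2 M\<close> in
  at least \<open>M\<close> ways, so the left hand side is dominated by a sum over all pairs \<open>(h, h')\<close>. This
  gives every integer \<open>N\<close> the triangular weight \<open>2 M - \<bar>N\<bar>\<close>, and expanding the square produces the
  squared Dirichlet kernels on the right. Their quadratic decay keeps the off-diagonal terms as small as
  the diagonal ones, whereas an unweighted sum over \<open>N\<close> would lose a logarithm.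
\<close>

lemma sum_norm_exp_poly_le:
  fixes a :: "'i \<Rightarrow> complex" and x :: "'i \<Rightarrow> real"
  assumes fin: "finite I"
  shows "real M * (\<Sum>N=1..M. (cmod (\<Sum>i\<in>I. a i * cis (2 * pi * x i * real N)))\<^sup>2)
       \<le> (\<Sum>i\<in>I. \<Sum>j\<in>I. cmod (a i) * cmod (a j) * (cmod (exp_sum (2 * M) (x i - x j)))\<^sup>2)"
proof -
  define e where "e i h = cis (2 * pi * x i * real h)" for i and h :: nat
  define A where "A h h' = (\<Sum>i\<in>I. a i * (e i h * cnj (e i h')))" for h h'
  have shift: "A (h' + N) h' = (\<Sum>i\<in>I. a i * cis (2 * pi * x i * real N))" for h' N
    unfolding A_def e_def by (intro sum.cong refl) (simp add: cis_cnj cis_mult algebra_simps)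
  have D: "(\<Sum>h<2*M. e i h * cnj (e j h)) = exp_sum (2 * M) (x i - x j)" for i j
    by (simp add: exp_sum_def e_def cis_cnj cis_mult algebra_simps)
  have "real M * (\<Sum>N=1..M. (cmod (\<Sum>i\<in>I. a i * cis (2 * pi * x i * real N)))\<^sup>2)
      = (\<Sum>N=1..M. \<Sum>h'<M. (cmod (A (h' + N) h'))\<^sup>2)"
    by (simp add: shift sum_distrib_left)
  also have "\<dots> = (\<Sum>(N, h')\<in>{1..M} \<times> {..<M}. (cmod (A (h' + N) h'))\<^sup>2)"
    by (rule sum.cartesian_product)
  also have "\<dots> = (\<Sum>(h, h')\<in>(\<lambda>(N, h'). (h' + N, h')) ` ({1..M} \<times> {..<M}). (cmod (A h h'))\<^sup>2)"
    by (subst sum.reindex) (auto simp: inj_on_def intro!: sum.cong)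
  also have "\<dots> \<le> (\<Sum>(h, h')\<in>{..<2*M} \<times> {..<2*M}. (cmod (A h h'))\<^sup>2)"
    by (intro sum_mono2) auto
  also have "\<dots> = (\<Sum>h<2*M. \<Sum>h'<2*M. (cmod (A h h'))\<^sup>2)"
    by (rule sum.cartesian_product[symmetric])
  finally have le: "real M * (\<Sum>N=1..M. (cmod (\<Sum>i\<in>I. a i * cis (2 * pi * x i * real N)))\<^sup>2)
      \<le> (\<Sum>h<2*M. \<Sum>h'<2*M. (cmod (A h h'))\<^sup>2)" .
  have "complex_of_real (\<Sum>h<2*M. \<Sum>h'<2*M. (cmod (A h h'))\<^sup>2)
      = (\<Sum>h<2*M. \<Sum>h'<2*M. A h h' * cnj (A h h'))"
    by (simp only: of_real_sum complex_norm_square)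
  also have "\<dots> = (\<Sum>h<2*M. \<Sum>h'<2*M. \<Sum>i\<in>I. \<Sum>j\<in>I. a i * cnj (a j) *
        ((e i h * cnj (e j h)) * cnj (e i h' * cnj (e j h'))))"
    unfolding A_def cnj_sum sum_product by (intro sum.cong refl) (simp add: mult_ac)
  also have "\<dots> = (\<Sum>i\<in>I. \<Sum>j\<in>I. \<Sum>h<2*M. \<Sum>h'<2*M. a i * cnj (a j) *
        ((e i h * cnj (e j h)) * cnj (e i h' * cnj (e j h'))))"
    by (simp only: sum.swap[of _ I "{..<2*M}"])
  also have "\<dots> = (\<Sum>i\<in>I. \<Sum>j\<in>I. a i * cnj (a j) *
        ((\<Sum>h<2*M. e i h * cnj (e j h)) * cnj (\<Sum>h<2*M. e i h * cnj (e j h))))"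
    unfolding cnj_sum sum_product by (simp add: sum_distrib_left)
  also have "\<dots> = (\<Sum>i\<in>I. \<Sum>j\<in>I. a i * cnj (a j) * of_real ((cmod (exp_sum (2 * M) (x i - x j)))\<^sup>2))"
    unfolding D by (simp only: complex_norm_square)
  finally have eq: "complex_of_real (\<Sum>h<2*M. \<Sum>h'<2*M. (cmod (A h h'))\<^sup>2) = \<dots>" .
  have "(\<Sum>h<2*M. \<Sum>h'<2*M. (cmod (A h h'))\<^sup>2) = cmod (complex_of_real (\<Sum>h<2*M. \<Sum>h'<2*M. (cmod (A h h'))\<^sup>2))"
    by (simp only: norm_of_real) (simp add: sum_nonneg)
  also have "\<dots> \<le> (\<Sum>i\<in>I. \<Sum>j\<in>I. cmod (a i) * cmod (a j) * (cmod (exp_sum (2 * M) (x i - x j)))\<^sup>2)"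
    unfolding eq by (intro sum_norm_le) (simp add: norm_mult norm_power)
  finally show ?thesis using le by linarith
qed

section \<open>Sums over multiples of a badly approximable number\<close>

locale badly_approximable_by =
  fixes \<alpha> c :: real
  assumes c_pos: "c > 0"
    and dist_ge: "\<And>k::int. k \<noteq> 0 \<Longrightarrow> c / \<bar>k\<bar> \<le> dist_nearest_int (of_int k * \<alpha>)"
begin

lemma dist_diff_ge:
  fixes m n X :: nat
  assumes "m \<noteq> n" "\<bar>int m - int n\<bar> \<le> int X"
  shows "c / real X \<le> dist_nearest_int (real m * \<alpha> - real n * \<alpha>)"
proof -
  let ?k = "int m - int n"
  have "real_of_int \<bar>?k\<bar> \<le> real X" "real_of_int \<bar>?k\<bar> > 0"
    using assms by linarith+
  then have "c / real X \<le> c / real_of_int \<bar>?k\<bar>"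
    using c_pos by (intro divide_left_mono mult_pos_pos) auto
  also have "\<dots> \<le> dist_nearest_int (of_int ?k * \<alpha>)"
    by (rule dist_ge) (use assms in auto)
  finally show ?thesis by (simp add: algebra_simps)
qed

lemma sin_pos:
  assumes "m \<ge> (1::nat)"
  shows "0 < \<bar>sin (pi * (real m * \<alpha>))\<bar>"
proof -
  have "0 < c / real m" using assms c_pos by simp
  also have "\<dots> \<le> dist_nearest_int (real m * \<alpha>)"
    using dist_diff_ge[of m 0 m] assms by simp
  finally show ?thesis
    using abs_sin_pi_ge_dist[of "real m * \<alpha>"] by linarith
qed

text \<open>
  The points \<open>n \<alpha>\<close> with \<open>0 \<le> n \<le> X\<close> are \<open>c / X\<close>-separated modulo 1. Since 0 is one of them, the
  terms are also bounded by a multiple of \<open>(X / c)\<^sup>2\<close>.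
\<close>

lemma sum_inverse_sin_squared_le:
  "(\<Sum>n=1..X. 1 / (sin (pi * (real n * \<alpha>)))\<^sup>2) \<le> 3 / (2 * c\<^sup>2) * (real X)\<^sup>2"
proof (cases "X = 0")
  case False
  have sq: "1 / (sin (pi * x))\<^sup>2 \<le> (1 / 4) / d\<^sup>2" if "0 < d" "d \<le> dist_nearest_int x" for d x
  proof -
    have le: "2 * d \<le> \<bar>sin (pi * x)\<bar>" using abs_sin_pi_ge_dist[of x] that by linarith
    have "(2 * d)\<^sup>2 \<le> (sin (pi * x))\<^sup>2"
      using power_mono[OF le, of 2] that by simp
    then have "1 / (sin (pi * x))\<^sup>2 \<le> 1 / (2 * d)\<^sup>2"
      using that by (intro divide_left_mono mult_pos_pos) (auto intro: less_le_trans[rotated])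
    then show ?thesis by (simp add: power2_eq_square)
  qed
  have dX: "c / real X > 0" using False c_pos by simp
  have "(\<Sum>n=1..X. 1 / (sin (pi * (real n * \<alpha>)))\<^sup>2)
      \<le> 2 * ((1 / 4) / (c / real X)\<^sup>2) + 4 * (1 / 4) / (c / real X)\<^sup>2"
  proof (rule sum_le_of_separated_mod_1[where x = "\<lambda>n. real n * \<alpha>"])
    show "c / real X \<le> dist_nearest_int (real i * \<alpha> - real j * \<alpha>)"
      if "i \<in> {1..X}" "j \<in> {1..X}" "i \<noteq> j" for i j
      using that by (intro dist_diff_ge) auto
    show "1 / (sin (pi * (real i * \<alpha>)))\<^sup>2 \<le> 1 / 4 / (c / real X)\<^sup>2" if "i \<in> {1..X}" for i
      using sq[OF dX] dist_diff_ge[of i 0 X] that by simp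
  qed (use dX sq in auto)
  also have "\<dots> = 3 / (2 * c\<^sup>2) * (real X)\<^sup>2"
    using c_pos False by (simp add: field_simps)
  finally show ?thesis .
qed simp

text \<open>
  The partial sums of \<open>1 / sin\<^sup>2 (\<pi> m \<alpha>)\<close> grow quadratically, so on average these terms behave like
  \<open>m\<close>, and the weighted sum behaves like \<open>\<Sum>\<^sub>m r\<^sup>m / m\<close>. This is the source of the
  logarithmic size of the variance.
\<close>

lemma weighted_sum_inverse_sin_squared_le:
  assumes r: "0 \<le> r" "r < 1"
  shows "(\<Sum>m=1..L. r ^ m / (real m * sin (pi * (real m * \<alpha>)))\<^sup>2) \<le> - 3 / c\<^sup>2 * ln (1 - r)"
proof -
  define g where "g m = r ^ m / (real m)\<^sup>2" for m
  define U where "U n = 3 / (2 * c\<^sup>2) * (real n)\<^sup>2" for n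
  have "(\<Sum>m=1..L. 1 / (sin (pi * (real m * \<alpha>)))\<^sup>2 * g m)
      \<le> U 0 * g 1 + (\<Sum>k=1..L. (U k - U (k - 1)) * g k)"
  proof (rule sum_by_parts_le)
    show "(\<Sum>k=1..n. 1 / (sin (pi * (real k * \<alpha>)))\<^sup>2) \<le> U n" for n
      unfolding U_def by (rule sum_inverse_sin_squared_le)
    show "g (Suc k) \<le> g k" if "k \<ge> 1" for k
      unfolding g_def using that r
      by (intro frac_le power_decreasing power_mono) (auto intro: zero_le_power)
    show "0 \<le> g k" for k using r by (simp add: g_def)
  qed
  also have "\<dots> = (\<Sum>k=1..L. (U k - U (k - 1)) * g k)"
    by (simp add: U_def)
  also have "\<dots> \<le> (\<Sum>k=1..L. 3 / c\<^sup>2 * (r ^ k / real k))"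
  proof (intro sum_mono)
    fix k assume k: "k \<in> {1..L}"
    have "U k - U (k - 1) = 3 / (2 * c\<^sup>2) * (2 * real k - 1)"
    proof -
      have "(real k)\<^sup>2 - (real (k - 1))\<^sup>2 = 2 * real k - 1"
        using k by (simp add: of_nat_diff power2_eq_square algebra_simps)
      then show ?thesis unfolding U_def right_diff_distrib[symmetric] by (simp only:)
    qed
    also have "\<dots> \<le> 3 / (2 * c\<^sup>2) * (2 * real k)"
      by (intro mult_left_mono) auto
    finally have "(U k - U (k - 1)) * g k \<le> 3 / (2 * c\<^sup>2) * (2 * real k) * g k"
      using r by (intro mult_right_mono) (auto simp: g_def)
    also have "\<dots> = 3 / c\<^sup>2 * (r ^ k / real k)"
      using k c_pos by (simp add: g_def field_simps power2_eq_square)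
    finally show "(U k - U (k - 1)) * g k \<le> 3 / c\<^sup>2 * (r ^ k / real k)" .
  qed
  also have "\<dots> = 3 / c\<^sup>2 * (\<Sum>k=1..L. r ^ k / real k)"
    by (simp only: sum_distrib_left)
  also have "\<dots> \<le> 3 / c\<^sup>2 * (- ln (1 - r))"
  proof (intro mult_left_mono)
    have "(\<lambda>m. r ^ m / real m) sums (- ln (1 - r))"
      using log_poisson_kernel_sums[OF r, of 0] r by (simp add: ln_realpow)
    then show "(\<Sum>k=1..L. r ^ k / real k) \<le> - ln (1 - r)"
      using sum_le_suminf[of "\<lambda>m. r ^ m / real m" "{1..L}"] r by (auto simp: sums_iff)
  qed simp
  finally show ?thesis
    by (simp add: g_def power_mult_distrib mult.commute)
qed

text \<open>
  Among \<open>M\<close> consecutive values of \<open>k\<close>, the points \<open>(m - k) \<alpha>\<close> are \<open>c / M\<close>-separated modulo 1, and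
  the squared kernels sum to \<open>O(M\<^sup>2)\<close>. The weight \<open>r\<^sup>k\<close> with \<open>1 - r = 1 / (M + 1)\<close> makes only
  boundedly many such blocks count. The bound is uniform in the number \<open>L\<close> of terms.
\<close>

lemma weighted_sum_exp_sum_le:
  fixes M L m :: nat
  assumes M: "M \<ge> 1" and r: "r = real M / real (M + 1)"
  shows "(\<Sum>k=1..L. r ^ k * (cmod (exp_sum (2 * M) (real m * \<alpha> - real k * \<alpha>)))\<^sup>2)
         \<le> 3 * (8 + 1 / c\<^sup>2) * (real M)\<^sup>2"
proof -
  have r01: "0 \<le> r" "r < 1" using r by auto
  define K where "K = 8 + 1 / c\<^sup>2"
  have K: "K \<ge> 0" by (simp add: K_def)
  define f where "f k = (cmod (exp_sum (2 * M) (real m * \<alpha> - real k * \<alpha>)))\<^sup>2" for k :: nat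
  define U where "U n = K * (real M)\<^sup>2 * (real n / real M + 1)" for n :: nat
  have block: "(\<Sum>k=a+1..a+M. f k) \<le> K * (real M)\<^sup>2" for a
  proof -
    have "(\<Sum>k=a+1..a+M. f k) \<le> 2 * (2 * real M)\<^sup>2 + 4 * (1 / 4) / (c / real M)\<^sup>2"
    proof (rule sum_le_of_separated_mod_1[where x = "\<lambda>k. real m * \<alpha> - real k * \<alpha>"])
      show "c / real M \<le> dist_nearest_int (real m * \<alpha> - real i * \<alpha> - (real m * \<alpha> - real j * \<alpha>))"
        if "i \<in> {a+1..a+M}" "j \<in> {a+1..a+M}" "i \<noteq> j" for i j
      proof -
        have "\<bar>int j - int i\<bar> \<le> int M" using that by auto
        with that show ?thesis using dist_diff_ge[of j i M] by simp
      qed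
      show "f i \<le> (2 * real M)\<^sup>2" for i
        unfolding f_def using norm_exp_sum_le_length[of "2 * M"] by (intro power_mono) auto
      show "f i \<le> 1 / 4 / (dist_nearest_int (real m * \<alpha> - real i * \<alpha>))\<^sup>2"
        if "dist_nearest_int (real m * \<alpha> - real i * \<alpha>) > 0" for i
        using power_mono[OF norm_exp_sum_le_dist[OF that, of "2 * M"], of 2]
        by (simp add: f_def power2_eq_square)
    qed (use M c_pos in auto)
    also have "\<dots> = K * (real M)\<^sup>2"
      using M c_pos by (simp add: K_def field_simps power2_eq_square)
    finally show ?thesis .
  qed
  have "(\<Sum>k=1..L. f k * r ^ k) \<le> U 0 * r ^ 1 + (\<Sum>k=1..L. (U k - U (k - 1)) * r ^ k)"
  proof (rule sum_by_parts_le)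
    show "(\<Sum>k=1..n. f k) \<le> U n" for n
      unfolding U_def using M block by (intro sum_le_by_blocks) (auto simp: f_def)
  qed (use r01 in \<open>auto intro: mult_left_le_one_le\<close>)
  also have "(\<Sum>k=1..L. (U k - U (k - 1)) * r ^ k) = K * real M * (\<Sum>k=1..L. r ^ k)"
    unfolding sum_distrib_left
  proof (intro sum.cong refl)
    fix k assume "k \<in> {1..L}"
    then show "(U k - U (k - 1)) * r ^ k = K * real M * r ^ k"
      using M by (simp add: U_def of_nat_diff field_simps power2_eq_square)
  qed
  finally have "(\<Sum>k=1..L. f k * r ^ k) \<le> U 0 * r + K * real M * (\<Sum>k=1..L. r ^ k)"
    by simp
  moreover have "K * real M * (\<Sum>k=1..L. r ^ k) \<le> K * real M * real (M + 1)"
  proof -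
    have "(\<Sum>k=1..L. r ^ k) \<le> (\<Sum>k. r ^ k)"
      using r01 by (intro sum_le_suminf summable_geometric) auto
    also have "\<dots> = 1 / (1 - r)" using r01 by (intro suminf_geometric) auto
    also have "\<dots> = real (M + 1)" by (simp add: r field_simps)
    finally show ?thesis using K by (intro mult_left_mono) auto
  qed
  moreover have "U 0 * r \<le> K * (real M)\<^sup>2"
    using r01 K by (simp add: U_def mult_left_le)
  moreover have "K * (real M)\<^sup>2 + K * real M * real (M + 1) \<le> 3 * K * (real M)\<^sup>2"
  proof -
    have "K * (real M * 1) \<le> K * (real M * real M)"
      using M K by (intro mult_left_mono) auto
    then show ?thesis by (simp add: algebra_simps power2_eq_square)
  qed
  ultimately have "(\<Sum>k=1..L. f k * r ^ k) \<le> 3 * K * (real M)\<^sup>2" by linarith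
  then show ?thesis by (simp only: f_def K_def mult.commute)
qed

section \<open>The oscillating part of the Sudler product\<close>

text \<open>
  The weight of the oscillating term \<open>sin ((2 N + 1) \<pi> m \<alpha>)\<close>, which arises from the \<open>m\<close>-th Fourier
  coefficient \<open>- r\<^sup>m / m\<close> of the smoothed function and the denominator \<open>sin (\<pi> m \<alpha>)\<close> of a Dirichlet
  kernel. For \<open>m = 0\<close> the value is 0, as division by zero gives zero.
\<close>

definition osc_weight :: "real \<Rightarrow> nat \<Rightarrow> real" where
  "osc_weight r m = r ^ m / (real m * sin (pi * (real m * \<alpha>)))"

text \<open>
  The product of the constants in \<open>weighted_sum_exp_sum_le\<close> and
  \<open>weighted_sum_inverse_sin_squared_le\<close>.
\<close>

definition osc_const :: real where
  "osc_const = 9 * (8 + 1 / c\<^sup>2) / c\<^sup>2"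

text \<open>
  This is where the variance is bounded. In the large sieve inequality the coefficients are
  \<open>r\<^sup>m \<beta>\<^sub>m\<close> with \<open>\<beta>\<^sub>m = 1 / \<bar>m sin (\<pi> m \<alpha>)\<bar>\<close>; the estimate \<open>\<beta>\<^sub>m \<beta>\<^sub>k \<le> (\<beta>\<^sub>m\<^sup>2 + \<beta>\<^sub>k\<^sup>2) / 2\<close> decouples them
  while leaving a factor \<open>r\<^sup>k\<close> with the kernel, so that the sum over \<open>k\<close> is \<open>O(M\<^sup>2)\<close> and the
  remaining sum over \<open>m\<close> is \<open>O(log M)\<close>. Both bounds are independent of \<open>L\<close>.
\<close>

lemma osc_partial_second_moment:
  assumes M: "M \<ge> 1" and r: "r = real M / real (M + 1)"
  shows "(\<Sum>N=1..M. (\<Sum>m=1..L. osc_weight r m * sin ((2 * real N + 1) * (pi * (real m * \<alpha>))))\<^sup>2)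
         \<le> osc_const * real M * ln (real (M + 1))"
proof -
  have r01: "0 \<le> r" "r < 1" using r by auto
  define \<beta> where "\<beta> m = 1 / \<bar>real m * sin (pi * (real m * \<alpha>))\<bar>" for m
  define a where "a m = of_real (osc_weight r m) * cis (pi * (real m * \<alpha>))" for m
  define D where "D m k = (cmod (exp_sum (2 * M) (real m * \<alpha> - real k * \<alpha>)))\<^sup>2" for m k :: nat
  have D_sym: "D m k = D k m" for m k
    unfolding D_def using norm_exp_sum_minus[of "2 * M" "real k * \<alpha> - real m * \<alpha>"] by simp
  have norm_a: "cmod (a m) = r ^ m * \<beta> m" for m
  proof -
    have "cmod (a m) = \<bar>osc_weight r m\<bar>" by (simp add: a_def norm_mult)
    then show ?thesis using r01 by (simp add: \<beta>_def osc_weight_def abs_mult)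
  qed
  have osc_le: "(\<Sum>m=1..L. osc_weight r m * sin ((2 * real N + 1) * (pi * (real m * \<alpha>))))\<^sup>2
      \<le> (cmod (\<Sum>m=1..L. a m * cis (2 * pi * (real m * \<alpha>) * real N)))\<^sup>2" for N
  proof -
    have "osc_weight r m * sin ((2 * real N + 1) * (pi * (real m * \<alpha>)))
        = Im (a m * cis (2 * pi * (real m * \<alpha>) * real N))" for m
    proof -
      have "a m * cis (2 * pi * (real m * \<alpha>) * real N)
          = of_real (osc_weight r m) * cis ((2 * real N + 1) * (pi * (real m * \<alpha>)))"
        by (simp add: a_def mult.assoc cis_mult algebra_simps)
      then show ?thesis by simp
    qed
    then have "(\<Sum>m=1..L. osc_weight r m * sin ((2 * real N + 1) * (pi * (real m * \<alpha>))))
        = Im (\<Sum>m=1..L. a m * cis (2 * pi * (real m * \<alpha>) * real N))"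
      by simp
    also have "\<bar>\<dots>\<bar> \<le> cmod (\<Sum>m=1..L. a m * cis (2 * pi * (real m * \<alpha>) * real N))"
      by (rule abs_Im_le_cmod)
    finally show ?thesis by (simp only: abs_le_square_iff[symmetric])
  qed
  have sum_\<beta>: "(\<Sum>m=1..L. r ^ m * (\<beta> m)\<^sup>2) \<le> 3 / c\<^sup>2 * ln (real (M + 1))"
  proof -
    have "1 - r = 1 / real (M + 1)" by (simp add: r field_simps)
    then have "ln (1 - r) = - ln (real (M + 1))" by (simp only: ln_div) (simp add: ln_div)
    then show ?thesis
      using weighted_sum_inverse_sin_squared_le[OF r01, of L]
      by (simp add: \<beta>_def power_divide)
  qed
  have "real M * (\<Sum>N=1..M. (\<Sum>m=1..L. osc_weight r m * sin ((2 * real N + 1) * (pi * (real m * \<alpha>))))\<^sup>2)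
      \<le> real M * (\<Sum>N=1..M. (cmod (\<Sum>m=1..L. a m * cis (2 * pi * (real m * \<alpha>) * real N)))\<^sup>2)"
    by (intro mult_left_mono sum_mono osc_le) auto
  also have "\<dots> \<le> (\<Sum>m=1..L. \<Sum>k=1..L. cmod (a m) * cmod (a k) * D m k)"
    unfolding D_def by (rule sum_norm_exp_poly_le) simp
  also have "\<dots> \<le> (\<Sum>m=1..L. \<Sum>k=1..L. (r ^ m * (\<beta> m)\<^sup>2 * (r ^ k * D m k) + r ^ k * (\<beta> k)\<^sup>2 * (r ^ m * D k m)) / 2)"
  proof (intro sum_mono)
    fix m k
    have "0 \<le> r ^ m * r ^ k * D m k * (\<beta> m - \<beta> k)\<^sup>2"
      using r01 by (simp add: D_def)
    then show "cmod (a m) * cmod (a k) * D m k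
        \<le> (r ^ m * (\<beta> m)\<^sup>2 * (r ^ k * D m k) + r ^ k * (\<beta> k)\<^sup>2 * (r ^ m * D k m)) / 2"
      unfolding norm_a D_sym[of k m] by (simp add: algebra_simps power2_eq_square)
  qed
  also have "\<dots> = (\<Sum>m=1..L. r ^ m * (\<beta> m)\<^sup>2 * (\<Sum>k=1..L. r ^ k * D m k))"
  proof -
    have "(\<Sum>m=1..L. \<Sum>k=1..L. r ^ k * (\<beta> k)\<^sup>2 * (r ^ m * D k m))
        = (\<Sum>m=1..L. \<Sum>k=1..L. r ^ m * (\<beta> m)\<^sup>2 * (r ^ k * D m k))"
      by (rule sum.swap)
    then show ?thesis
      by (simp add: add_divide_distrib sum.distrib sum_distrib_left flip: sum_divide_distrib)
  qed
  also have "\<dots> \<le> (\<Sum>m=1..L. r ^ m * (\<beta> m)\<^sup>2 * (3 * (8 + 1 / c\<^sup>2) * (real M)\<^sup>2))"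
    unfolding D_def using r01
    by (intro sum_mono mult_left_mono weighted_sum_exp_sum_le[OF M r]) auto
  also have "\<dots> = (\<Sum>m=1..L. r ^ m * (\<beta> m)\<^sup>2) * (3 * (8 + 1 / c\<^sup>2) * (real M)\<^sup>2)"
    by (simp only: sum_distrib_right)
  also have "\<dots> \<le> 3 / c\<^sup>2 * ln (real (M + 1)) * (3 * (8 + 1 / c\<^sup>2) * (real M)\<^sup>2)"
    by (intro mult_right_mono sum_\<beta>) auto
  also have "\<dots> = real M * (osc_const * real M * ln (real (M + 1)))"
    by (simp add: osc_const_def power2_eq_square)
  finally show ?thesis using M by simp
qed

section \<open>Second moment of the logarithm of the Sudler product\<close>

lemma sudler_pos: "sudler N \<alpha> > 0"
  unfolding sudler_def
proof (intro prod_pos)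
  fix n assume "n \<in> {1..N}"
  then show "0 < \<bar>2 * sin (pi * real n * \<alpha>)\<bar>"
    using sin_pos[of n] by (simp add: mult.assoc)
qed

lemma ln_sudler: "ln (sudler N \<alpha>) = (\<Sum>n=1..N. ln \<bar>2 * sin (pi * (real n * \<alpha>))\<bar>)"
  unfolding sudler_def
  by (subst ln_prod) (use sin_pos in \<open>auto simp: mult.assoc\<close>)

text \<open>
  Bounds the sum over \<open>n \<le> M\<close> of the errors in \<open>abs_ln_sin_minus_ln_poisson_le\<close> at \<open>x = n \<alpha>\<close>: the
  two summands of the error contribute one term each, as \<open>1 / r - 1 = 1 / M\<close> and \<open>1 - r \<le> 1 / M\<close>.
\<close>

definition smooth_const :: real where
  "smooth_const = 1 / 2 + 3 / (16 * c\<^sup>2)"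

text \<open>
  Summing the Fourier series of the smoothed function over \<open>n \<alpha>\<close> for \<open>n \<le> N\<close>, each Dirichlet kernel
  splits into a constant \<open>- 1 / 2\<close> and an oscillating quotient of sines. The constants add up to
  \<open>\<Sum>\<^sub>m r\<^sup>m / (2 m) = ln (M + 1) / 2\<close>: this is where the exponent \<open>1 / 2\<close> of \<open>N\<close> comes from. The limit
  \<open>V\<close> is the oscillating part.
\<close>

lemma ln_sudler_decomposition:
  assumes M: "M \<ge> 1" and r: "r = real M / real (M + 1)" and N: "N \<le> M"
  obtains V where
    "(\<lambda>L. \<Sum>m=1..L. osc_weight r m * sin ((2 * real N + 1) * (pi * (real m * \<alpha>)))) \<longlonglongrightarrow> V"
    "\<bar>ln (sudler N \<alpha>) - ln (real (M + 1)) / 2 + V / 2\<bar> \<le> smooth_const"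
proof -
  have r01: "0 < r" "r < 1" "0 \<le> r" using r M by auto
  have r1: "1 - r = 1 / real (M + 1)" by (simp add: r field_simps)
  then have ln_r: "- ln (1 - r) = ln (real (M + 1))" by (simp only: ln_div) (simp add: ln_div)
  define f where "f x = ln ((1 - r)\<^sup>2 + 4 * r * (sin (pi * x))\<^sup>2) / 2" for x
  define F where "F = (\<Sum>n=1..N. f (real n * \<alpha>))"
  have sums_f: "(\<lambda>m. r ^ m * cos (2 * pi * real m * x) / real m) sums (- f x)" for x
    unfolding f_def using log_poisson_kernel_sums[of r x] r01 by simp
  have "(\<lambda>m. \<Sum>n=1..N. r ^ m * cos (2 * pi * real m * (real n * \<alpha>)) / real m)
      sums (\<Sum>n=1..N. - f (real n * \<alpha>))"
    by (intro sums_sum sums_f)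
  then have sF: "(\<lambda>m. r ^ m / real m * (\<Sum>n=1..N. cos (2 * real n * (pi * (real m * \<alpha>))))) sums (- F)"
    by (simp add: F_def sum_negf sum_distrib_left mult_ac)
  have s0: "(\<lambda>m. r ^ m / real m) sums ln (real (M + 1))"
    using sums_f[of 0] ln_r r01 by (simp add: f_def ln_realpow)
  have "osc_weight r m * sin ((2 * real N + 1) * (pi * (real m * \<alpha>)))
      = 2 * (r ^ m / real m * (\<Sum>n=1..N. cos (2 * real n * (pi * (real m * \<alpha>))))) + r ^ m / real m" for m
  proof (cases "m = 0")
    case False
    then have "sin (pi * (real m * \<alpha>)) \<noteq> 0" using sin_pos[of m] by simp
    then show ?thesis
      unfolding sum_cos_dirichlet[OF \<open>sin (pi * (real m * \<alpha>)) \<noteq> 0\<close>]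
      by (simp add: osc_weight_def right_diff_distrib diff_divide_distrib)
  qed (simp add: osc_weight_def)
  with sums_add[OF sums_mult[OF sF, of 2] s0]
  have sV: "(\<lambda>m. osc_weight r m * sin ((2 * real N + 1) * (pi * (real m * \<alpha>))))
      sums (2 * (- F) + ln (real (M + 1)))"
    by (simp only:)
  show thesis
  proof (rule that)
    \<comment> \<open>The index 0 contributes nothing.\<close>
    have "(\<Sum>m<Suc L. osc_weight r m * sin ((2 * real N + 1) * (pi * (real m * \<alpha>))))
        = (\<Sum>m=1..L. osc_weight r m * sin ((2 * real N + 1) * (pi * (real m * \<alpha>))))" for L
      unfolding lessThan_Suc_atMost atMost_atLeast0
      by (subst sum.atLeast_Suc_atMost) (auto simp: osc_weight_def)
    with LIMSEQ_Suc[OF sV[unfolded sums_def]]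
    show "(\<lambda>L. \<Sum>m=1..L. osc_weight r m * sin ((2 * real N + 1) * (pi * (real m * \<alpha>))))
        \<longlonglongrightarrow> 2 * (- F) + ln (real (M + 1))"
      by (simp only:)
    have "\<bar>ln (sudler N \<alpha>) - F\<bar> = \<bar>\<Sum>n=1..N. ln \<bar>2 * sin (pi * (real n * \<alpha>))\<bar> - f (real n * \<alpha>)\<bar>"
      by (simp only: ln_sudler F_def sum_subtractf)
    also have "\<dots> \<le> (\<Sum>n=1..N. (1 / r - 1) / 2 + (1 - r)\<^sup>2 / 8 * (1 / (sin (pi * (real n * \<alpha>)))\<^sup>2))"
    proof (intro order.trans[OF sum_abs] sum_mono)
      fix n assume "n \<in> {1..N}"
      then have "sin (pi * (real n * \<alpha>)) \<noteq> 0" using sin_pos[of n] by auto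
      then show "\<bar>ln \<bar>2 * sin (pi * (real n * \<alpha>))\<bar> - f (real n * \<alpha>)\<bar>
          \<le> (1 / r - 1) / 2 + (1 - r)\<^sup>2 / 8 * (1 / (sin (pi * (real n * \<alpha>)))\<^sup>2)"
        unfolding f_def by (intro abs_ln_sin_minus_ln_poisson_le r01)
    qed
    also have "\<dots> \<le> (\<Sum>n=1..M. (1 / r - 1) / 2 + (1 - r)\<^sup>2 / 8 * (1 / (sin (pi * (real n * \<alpha>)))\<^sup>2))"
      using N r01 by (intro sum_mono2 add_nonneg_nonneg mult_nonneg_nonneg) (auto simp: field_simps)
    also have "\<dots> = real M * ((1 / r - 1) / 2) + (1 - r)\<^sup>2 / 8 * (\<Sum>n=1..M. 1 / (sin (pi * (real n * \<alpha>)))\<^sup>2)"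
      by (simp add: sum.distrib sum_distrib_left)
    also have "\<dots> \<le> 1 / 2 + (1 / (real M)\<^sup>2) / 8 * (3 / (2 * c\<^sup>2) * (real M)\<^sup>2)"
    proof (intro add_mono mult_mono sum_inverse_sin_squared_le)
      show "real M * ((1 / r - 1) / 2) \<le> 1 / 2" using M by (simp add: r field_simps)
      show "(1 - r)\<^sup>2 / 8 \<le> 1 / (real M)\<^sup>2 / 8"
        using M unfolding r1 power_divide by (intro divide_right_mono frac_le power_mono) auto
    qed (auto intro: sum_nonneg)
    also have "\<dots> = smooth_const" using M by (simp add: smooth_const_def)
    finally show "\<bar>ln (sudler N \<alpha>) - ln (real (M + 1)) / 2 + (2 * (- F) + ln (real (M + 1))) / 2\<bar> \<le> smooth_const"
      by (simp add: field_simps)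
  qed
qed

lemma ln_sudler_second_moment:
  assumes M: "M \<ge> 1"
  shows "(\<Sum>N=1..M. (ln (sudler N \<alpha>) - ln (real (M + 1)) / 2)\<^sup>2)
         \<le> 2 * smooth_const\<^sup>2 * real M + osc_const / 2 * real M * ln (real (M + 1))"
proof -
  define r where "r = real M / real (M + 1)"
  define W where "W = (\<lambda>N L. \<Sum>m=1..L. osc_weight r m * sin ((2 * real N + 1) * (pi * (real m * \<alpha>))))"
  have "\<exists>V. W N \<longlonglongrightarrow> V \<and> \<bar>ln (sudler N \<alpha>) - ln (real (M + 1)) / 2 + V / 2\<bar> \<le> smooth_const"
    if "N \<le> M" for N
    by (rule ln_sudler_decomposition[OF M r_def that]) (unfold W_def, rule exI, rule conjI)
  then have "\<forall>N\<in>{..M}. \<exists>V. W N \<longlonglongrightarrow> V \<and> \<bar>ln (sudler N \<alpha>) - ln (real (M + 1)) / 2 + V / 2\<bar> \<le> smooth_const"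
    by simp
  from bchoice[OF this] obtain V where V: "\<And>N. N \<le> M \<Longrightarrow> W N \<longlonglongrightarrow> V N"
    and dev: "\<And>N. N \<le> M \<Longrightarrow> \<bar>ln (sudler N \<alpha>) - ln (real (M + 1)) / 2 + V N / 2\<bar> \<le> smooth_const"
    by auto
  have "(\<lambda>L. \<Sum>N=1..M. (W N L)\<^sup>2) \<longlonglongrightarrow> (\<Sum>N=1..M. (V N)\<^sup>2)"
    by (intro tendsto_sum tendsto_power V) auto
  then have V2: "(\<Sum>N=1..M. (V N)\<^sup>2) \<le> osc_const * real M * ln (real (M + 1))"
    by (rule LIMSEQ_le_const2) (intro exI allI impI, unfold W_def, rule osc_partial_second_moment[OF M r_def])
  have "(\<Sum>N=1..M. (ln (sudler N \<alpha>) - ln (real (M + 1)) / 2)\<^sup>2) \<le> (\<Sum>N=1..M. 2 * smooth_const\<^sup>2 + (V N)\<^sup>2 / 2)"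
  proof (intro sum_mono)
    fix N assume "N \<in> {1..M}"
    let ?e = "ln (sudler N \<alpha>) - ln (real (M + 1)) / 2 + V N / 2"
    have "\<bar>?e\<bar> \<le> smooth_const" using dev[of N] \<open>N \<in> {1..M}\<close> by simp
    then have "?e\<^sup>2 \<le> smooth_const\<^sup>2" using power_mono[of "\<bar>?e\<bar>" smooth_const 2] by simp
    moreover have "(?e + (- V N / 2))\<^sup>2 \<le> 2 * ?e\<^sup>2 + 2 * (- V N / 2)\<^sup>2" by (rule square_add_le)
    ultimately show "(ln (sudler N \<alpha>) - ln (real (M + 1)) / 2)\<^sup>2 \<le> 2 * smooth_const\<^sup>2 + (V N)\<^sup>2 / 2"
      by (simp add: power_divide)
  qed
  also have "\<dots> = 2 * smooth_const\<^sup>2 * real M + (\<Sum>N=1..M. (V N)\<^sup>2) / 2"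
    by (simp add: sum.distrib sum_divide_distrib)
  finally show ?thesis using V2 by simp
qed

section \<open>Concentration and density\<close>

definition deviant :: "real \<Rightarrow> nat set" where
  "deviant t = {N. t * sqrt (ln (2 * real N)) < \<bar>ln (sudler N \<alpha>) - ln (real N) / 2\<bar>}"

text \<open>
  Twice the second moment bound contributes \<open>4 smooth_const\<^sup>2 M + osc_const M ln (M + 1)\<close>, and replacing
  \<open>ln (M + 1)\<close> by \<open>ln N\<close> contributes \<open>M\<close>; the terms without a logarithm are doubled
  because \<open>1 \<le> 2 ln (M + 1)\<close>.
\<close>

definition tail_const :: real where
  "tail_const = 8 * smooth_const\<^sup>2 + osc_const + 2"

lemma osc_const_pos: "osc_const > 0"
  using c_pos by (auto simp: osc_const_def intro!: add_pos_nonneg divide_pos_pos mult_pos_pos)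

lemma tail_const_pos: "tail_const > 0"
  using osc_const_pos by (simp add: tail_const_def add_nonneg_pos)

text \<open>
  Chebyshev's inequality. The range is restricted to \<open>N > M / 2\<close> because there \<open>ln N\<close> and
  \<open>ln (2 N)\<close> agree with \<open>ln (M + 1)\<close> up to a bounded error; for much smaller \<open>N\<close> the second moment,
  which is centred at \<open>ln (M + 1) / 2\<close>, says little about the deviation from \<open>ln N / 2\<close>.
\<close>

lemma card_deviant_upper_half_le:
  assumes M: "M \<ge> 1" and t: "t > 0"
  shows "real (card (deviant t \<inter> {M div 2 + 1..M})) \<le> tail_const * real M / t\<^sup>2"
proof -
  define l where "l = ln (real (M + 1))"
  have "ln 2 \<le> l" unfolding l_def using M by (subst ln_le_cancel_iff) auto
  then have l: "l \<ge> 1 / 2" using ln2_ge_two_thirds by simp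
  define B where "B = deviant t \<inter> {M div 2 + 1..M}"
  define Z where "Z N = ln (sudler N \<alpha>) - ln (real (M + 1)) / 2" for N
  have "real (card B) * (t\<^sup>2 * l) = (\<Sum>N\<in>B. t\<^sup>2 * l)" by simp
  also have "\<dots> \<le> (\<Sum>N\<in>B. 2 * (Z N)\<^sup>2 + 1)"
  proof (intro sum_mono)
    fix N assume N: "N \<in> B"
    then have N1: "1 \<le> N" "N \<le> M" "M + 1 \<le> 2 * N" by (auto simp: B_def)
    have l_le: "l \<le> ln (2 * real N)"
      unfolding l_def using N1 by (subst ln_le_cancel_iff) auto
    have dev: "t * sqrt (ln (2 * real N)) < \<bar>ln (sudler N \<alpha>) - ln (real N) / 2\<bar>"
      using N by (simp add: B_def deviant_def)
    have "t\<^sup>2 * l \<le> t\<^sup>2 * ln (2 * real N)"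
      using l_le by (intro mult_left_mono) auto
    also have "\<dots> = (t * sqrt (ln (2 * real N)))\<^sup>2"
      using l l_le by (simp add: power_mult_distrib)
    also have "\<dots> \<le> \<bar>ln (sudler N \<alpha>) - ln (real N) / 2\<bar>\<^sup>2"
      using dev t l l_le by (intro power_mono) auto
    also have "\<dots> = (Z N + (ln (real (M + 1)) - ln (real N)) / 2)\<^sup>2"
      by (simp add: Z_def diff_divide_distrib)
    also have "\<dots> \<le> 2 * (Z N)\<^sup>2 + 2 * ((ln (real (M + 1)) - ln (real N)) / 2)\<^sup>2"
      by (rule square_add_le)
    also have "((ln (real (M + 1)) - ln (real N)) / 2)\<^sup>2 \<le> (1 / 2)\<^sup>2"
    proof (intro power_mono)
      have "ln (real (M + 1)) \<le> ln (2 * real N)" using l_le by (simp add: l_def)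
      also have "\<dots> = ln 2 + ln (real N)" using N1 by (subst ln_mult) auto
      finally show "(ln (real (M + 1)) - ln (real N)) / 2 \<le> 1 / 2"
        using ln_2_less_1 by simp
      have "ln (real N) \<le> ln (real (M + 1))" using N1 by (subst ln_le_cancel_iff) auto
      then show "0 \<le> (ln (real (M + 1)) - ln (real N)) / 2" by simp
    qed
    finally show "t\<^sup>2 * l \<le> 2 * (Z N)\<^sup>2 + 1" by (simp add: power2_eq_square)
  qed
  also have "\<dots> \<le> (\<Sum>N=1..M. 2 * (Z N)\<^sup>2 + 1)"
    by (intro sum_mono2) (auto simp: B_def)
  also have "\<dots> = 2 * (\<Sum>N=1..M. (Z N)\<^sup>2) + real M"
    by (simp add: sum.distrib sum_distrib_left)
  also have "\<dots> \<le> 2 * (2 * smooth_const\<^sup>2 * real M + osc_const / 2 * real M * l) + real M"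
    unfolding Z_def l_def by (intro add_right_mono mult_left_mono ln_sudler_second_moment[OF M]) auto
  also have "\<dots> = (4 * smooth_const\<^sup>2 + 1) * real M * 1 + osc_const * real M * l"
    by (simp add: algebra_simps)
  also have "\<dots> \<le> (4 * smooth_const\<^sup>2 + 1) * real M * (2 * l) + osc_const * real M * l"
    using l by (intro add_right_mono mult_left_mono) auto
  also have "\<dots> \<le> tail_const * real M * l"
    by (simp add: tail_const_def algebra_simps)
  finally have "real (card B) * t\<^sup>2 \<le> tail_const * real M"
    using l by (simp add: algebra_simps)
  then show ?thesis using t unfolding B_def by (simp add: field_simps)
qed

text \<open>
  Halving \<open>M\<close> repeatedly, the bounds for the upper halves form a geometric series.
\<close>

lemma card_deviant_le:
  assumes t: "t > 0"
  shows "real (card (deviant t \<inter> {1..M})) \<le> 2 * tail_const * real M / t\<^sup>2"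
proof (induction M rule: less_induct)
  case (less M)
  show ?case
  proof (cases "M = 0")
    case False
    let ?K = "tail_const / t\<^sup>2"
    have K: "?K \<ge> 0" using tail_const_pos by simp
    have "deviant t \<inter> {1..M} = deviant t \<inter> {1..M div 2} \<union> deviant t \<inter> {M div 2 + 1..M}"
      by auto
    then have "real (card (deviant t \<inter> {1..M}))
        \<le> real (card (deviant t \<inter> {1..M div 2})) + real (card (deviant t \<inter> {M div 2 + 1..M}))"
      by (metis card_Un_le of_nat_add of_nat_mono)
    also have "\<dots> \<le> 2 * tail_const * real (M div 2) / t\<^sup>2 + tail_const * real M / t\<^sup>2"
      using False t by (intro add_mono less.IH card_deviant_upper_half_le) auto
    also have "\<dots> = ?K * (2 * real (M div 2) + real M)" by (simp add: add_divide_distrib algebra_simps)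
    also have "\<dots> \<le> ?K * (2 * real M)" by (intro mult_left_mono K) linarith
    finally show ?thesis by (simp add: algebra_simps)
  qed simp
qed

lemma sudler_between_iff:
  assumes "N \<ge> 1"
  shows "sqrt (real N) * exp (- s) \<le> sudler N \<alpha> \<and> sudler N \<alpha> \<le> sqrt (real N) * exp s
     \<longleftrightarrow> \<bar>ln (sudler N \<alpha>) - ln (real N) / 2\<bar> \<le> s"
proof -
  have eq: "sqrt (real N) * exp u = exp (ln (real N) / 2 + u)" for u
    using assms by (simp add: exp_add flip: ln_sqrt)
  have P: "sudler N \<alpha> = exp (ln (sudler N \<alpha>))" using sudler_pos[of N] by simp
  show ?thesis
    unfolding eq by (subst (1 2) P) (simp only: exp_le_cancel_iff abs_le_iff, linarith)
qed

lemma sudler_concentration: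
  assumes M: "M \<ge> 1" and t: "t > 0"
  shows "\<bar>1 / real M * real (card {N::nat. 1 \<le> N \<and> N \<le> M \<and>
                sqrt (real N) * exp (- t * sqrt (ln (2 * real N))) \<le> sudler N \<alpha> \<and>
                sudler N \<alpha> \<le> sqrt (real N) * exp (t * sqrt (ln (2 * real N)))}) - 1\<bar>
         \<le> 2 * tail_const / t\<^sup>2"
proof -
  have "{N::nat. 1 \<le> N \<and> N \<le> M \<and>
                sqrt (real N) * exp (- t * sqrt (ln (2 * real N))) \<le> sudler N \<alpha> \<and>
                sudler N \<alpha> \<le> sqrt (real N) * exp (t * sqrt (ln (2 * real N)))}
      = {1..M} - deviant t \<inter> {1..M}"
  proof (intro set_eqI)
    fix N
    show "N \<in> {N::nat. 1 \<le> N \<and> N \<le> M \<and>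
                sqrt (real N) * exp (- t * sqrt (ln (2 * real N))) \<le> sudler N \<alpha> \<and>
                sudler N \<alpha> \<le> sqrt (real N) * exp (t * sqrt (ln (2 * real N)))}
        \<longleftrightarrow> N \<in> {1..M} - deviant t \<inter> {1..M}"
      using sudler_between_iff[of N "t * sqrt (ln (2 * real N))"] by (auto simp: deviant_def not_less)
  qed
  then have "real (card {N::nat. 1 \<le> N \<and> N \<le> M \<and>
                sqrt (real N) * exp (- t * sqrt (ln (2 * real N))) \<le> sudler N \<alpha> \<and>
                sudler N \<alpha> \<le> sqrt (real N) * exp (t * sqrt (ln (2 * real N)))})
      = real M - real (card (deviant t \<inter> {1..M}))"
    using card_mono[of "{1..M}" "deviant t \<inter> {1..M}"]
    by (subst \<open>_ = {1..M} - _\<close>, subst card_Diff_subset) (auto simp: of_nat_diff)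
  then show ?thesis
    using card_deviant_le[OF t, of M] M by (simp add: field_simps)
qed

text \<open>
  For every fixed \<open>T\<close>, all but finitely many exceptional \<open>N\<close> are deviant for \<open>T\<close>, because
  \<open>ln (2 N) \<le> 4 ln N\<close> for \<open>N \<ge> 2\<close> and eventually \<open>t\<^sub>N \<ge> 2 T\<close>. So the upper density of the exceptional set is
  \<open>O(1 / T\<^sup>2)\<close> for every \<open>T\<close>.
\<close>

lemma sudler_density:
  assumes t: "filterlim t at_top sequentially"
  shows "has_asymptotic_density
              {N::nat. 1 \<le> N \<and>
                sqrt (real N) * exp (- t N * sqrt (ln (real N))) \<le> sudler N \<alpha> \<and>
                sudler N \<alpha> \<le> sqrt (real N) * exp (t N * sqrt (ln (real N)))} 1"
    (is "has_asymptotic_density ?A 1")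
  unfolding has_asymptotic_density_def
proof (rule LIMSEQ_I)
  fix \<epsilon> :: real assume \<epsilon>: "\<epsilon> > 0"
  \<comment> \<open>Chosen so that the deviant numbers have density at most half of \<open>\<epsilon>\<close>.\<close>
  define T where "T = sqrt (4 * tail_const / \<epsilon>)"
  have T: "T > 0" and T2: "2 * tail_const / T\<^sup>2 = \<epsilon> / 2"
    using \<epsilon> tail_const_pos by (simp_all add: T_def)
  have "eventually (\<lambda>N. t N \<ge> 2 * T) sequentially"
    using t by (simp add: filterlim_at_top)
  then obtain N1 where N1: "\<And>N. N \<ge> N1 \<Longrightarrow> t N \<ge> 2 * T"
    by (auto simp: eventually_sequentially)
  define N0 where "N0 = max N1 2"
  have sub: "{1..M} - ?A \<subseteq> {1..<N0} \<union> (deviant T \<inter> {1..M})" for M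
  proof (intro subsetI)
    fix N assume N: "N \<in> {1..M} - ?A"
    show "N \<in> {1..<N0} \<union> (deviant T \<inter> {1..M})"
    proof (cases "N < N0")
      case False
      then have N': "N \<ge> N1" "N \<ge> 2" by (auto simp: N0_def)
      have "ln (2 * real N) = ln 2 + ln (real N)" using N' by (subst ln_mult) auto
      also have "\<dots> \<le> ln (real N) + ln (real N)"
        using N' by (intro add_right_mono) (subst ln_le_cancel_iff, auto)
      also have "\<dots> \<le> 2\<^sup>2 * ln (real N)" using N' by simp
      finally have "sqrt (ln (2 * real N)) \<le> 2 * sqrt (ln (real N))"
        by (metis real_sqrt_abs real_sqrt_le_mono real_sqrt_mult abs_numeral)
      then have "T * sqrt (ln (2 * real N)) \<le> T * (2 * sqrt (ln (real N)))"
        using T by (intro mult_left_mono) auto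
      also have "\<dots> = 2 * T * sqrt (ln (real N))" by simp
      also have "\<dots> \<le> t N * sqrt (ln (real N))"
        using N1[OF N'(1)] N' by (intro mult_right_mono) auto
      also have "\<dots> < \<bar>ln (sudler N \<alpha>) - ln (real N) / 2\<bar>"
        using N N' sudler_between_iff[of N "t N * sqrt (ln (real N))"] by auto
      finally show ?thesis using N by (auto simp: deviant_def)
    qed (use N in auto)
  qed
  obtain M0 :: nat where M0: "2 * real N0 / \<epsilon> < real M0"
    using reals_Archimedean2 by blast
  show "\<exists>no. \<forall>M\<ge>no. norm (real (card (?A \<inter> {1..M})) / real M - 1) < \<epsilon>"
  proof (intro exI allI impI)
    fix M assume "M \<ge> max M0 1"
    then have M: "M \<ge> 1" "2 * real N0 / \<epsilon> < real M" using M0 by auto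
    have "card ({1..M} - ?A) \<le> card ({1..<N0} \<union> (deviant T \<inter> {1..M}))"
      by (intro card_mono sub) auto
    also have "\<dots> \<le> card {1..<N0} + card (deviant T \<inter> {1..M})" by (rule card_Un_le)
    finally have "real (card ({1..M} - ?A)) \<le> real N0 + real (card (deviant T \<inter> {1..M}))"
      by simp
    also have "\<dots> \<le> real N0 + 2 * tail_const / T\<^sup>2 * real M"
      using card_deviant_le[OF T, of M] by simp
    also have "\<dots> < \<epsilon> * real M"
      unfolding T2 using M \<epsilon> by (simp add: field_simps)
    finally have "real (card ({1..M} - ?A)) < \<epsilon> * real M" .
    moreover have "real (card (?A \<inter> {1..M})) + real (card ({1..M} - ?A)) = real M"
    proof -
      have "card ({1..M} \<inter> ?A) + card ({1..M} - ?A) = M"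
        using card_Int_Diff[of "{1..M}" ?A] by simp
      then show ?thesis by (simp add: Int_commute flip: of_nat_add)
    qed
    ultimately have "\<bar>real (card (?A \<inter> {1..M})) - real M\<bar> < \<epsilon> * real M" by linarith
    moreover have "real (card (?A \<inter> {1..M})) / real M - 1 = (real (card (?A \<inter> {1..M})) - real M) / real M"
      using M by (simp add: field_simps)
    ultimately show "norm (real (card (?A \<inter> {1..M})) / real M - 1) < \<epsilon>"
      using M by (simp add: pos_divide_less_eq)
  qed
qed

end

lemma badly_approximableE:
  assumes "badly_approximable \<alpha>"
  obtains c where "c > 0" "\<And>k::int. k \<noteq> 0 \<Longrightarrow> c / \<bar>k\<bar> \<le> dist_nearest_int (of_int k * \<alpha>)"
proof -
  define c where "c = (INF q\<in>{1::nat..}. real q * dist_nearest_int (real q * \<alpha>))"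
  have "c > 0" using assms by (simp add: badly_approximable_def c_def)
  moreover have "c / \<bar>k\<bar> \<le> dist_nearest_int (of_int k * \<alpha>)" if "k \<noteq> 0" for k :: int
  proof -
    let ?q = "nat \<bar>k\<bar>"
    have "bdd_below ((\<lambda>q::nat. real q * dist_nearest_int (real q * \<alpha>)) ` {1..})"
      by (rule bdd_belowI[of _ 0]) (auto simp: dist_nearest_int_nonneg)
    then have "c \<le> real ?q * dist_nearest_int (real ?q * \<alpha>)"
      unfolding c_def by (rule cINF_lower) (use that in auto)
    also have "dist_nearest_int (real ?q * \<alpha>) = dist_nearest_int (of_int k * \<alpha>)"
      using dist_nearest_int_minus[of "of_int k * \<alpha>"] by (simp add: abs_if)
    finally show ?thesis using that by (simp add: field_simps)
  qed
  ultimately show ?thesis by (rule that)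
qed

theorem theorem1:
  fixes \<alpha> :: real
  assumes "badly_approximable \<alpha>"
  shows "(\<exists>C>0. \<forall>M\<ge>1::nat. \<forall>t>0::real.
            \<bar>1 / real M * real (card {N::nat. 1 \<le> N \<and> N \<le> M \<and>
                sqrt (real N) * exp (- t * sqrt (ln (2 * real N))) \<le> sudler N \<alpha> \<and>
                sudler N \<alpha> \<le> sqrt (real N) * exp (t * sqrt (ln (2 * real N)))}) - 1\<bar>
              \<le> C / t\<^sup>2) \<and>
         (\<forall>t :: nat \<Rightarrow> real. filterlim t at_top sequentially \<longrightarrow>
            has_asymptotic_density
              {N::nat. 1 \<le> N \<and>
                sqrt (real N) * exp (- t N * sqrt (ln (real N))) \<le> sudler N \<alpha> \<and>
                sudler N \<alpha> \<le> sqrt (real N) * exp (t N * sqrt (ln (real N)))} 1)"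
proof -
  obtain c where "c > 0" "\<And>k::int. k \<noteq> 0 \<Longrightarrow> c / \<bar>k\<bar> \<le> dist_nearest_int (of_int k * \<alpha>)"
    using badly_approximableE[OF assms] by metis
  then interpret badly_approximable_by \<alpha> c by unfold_locales
  show ?thesis
  proof (intro conjI exI[of _ "2 * tail_const"] allI impI)
    show "2 * tail_const > 0" using tail_const_pos by simp
  qed (rule sudler_concentration sudler_density; assumption)+
qed

end
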